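(* Let $\mathcal N$ be a nested separation system of a finite graph $G$, let $\mathcal T=\mathcal T(\mathcal N)$ be its structure tree, and let $\mathcal V=(V_t)_{t\in\mathcal T}$ with $V_t=\bigcap\{A\mid (A,B)\in t\}$. Then the pair $(\mathcal T,\mathcal V)$ is a tree-decomposition of $G$. Moreover: (i) Every $\mathcal N$-block is a part of the decomposition. (ii) Every part of the decomposition is an $\mathcal N$-block or a hub. (iii) The separations of $G$ induced by the decomposition are precisely those in $\mathcal N$. (iv) Every separation system $\mathcal N'\subseteq\mathcal N$ satisfies $(\mathcal T',\mathcal V')\preccurlyeq(\mathcal T,\mathcal V)$, where $\mathcal T'=\mathcal T(\mathcal N')$ and $\mathcal V'=(V_t)_{t\in\mathcal T'}$.
   Context: Separations. A separation of $G=(V,E)$ is an ordered pair $(A,B)$ with $A,B\subseteq V$ and $G[A]\cup G[B]=G$; it is proper if $A\setminus B\ne\emptyset\ne B\setminus A$. Write $(A,B)\le(C,D)$ if $A\subseteq C$ and $B\supseteq D$. Two separations $(A,B),(C,D)$ are nested if $(A,B)$ is $\le$-comparable with $(C,D)$ or $(D,C)$. A separation system is a set of proper separations that contains $(B,A)$ whenever it contains $(A,B)$; it is nested if every two of its elements are nested. A set $I\subseteq V$ is separated by $(A,B)$ if it meets both $A\setminus B$ and $B\setminus A$; it is $\mathcal N$-inseparable if no element of $\mathcal N$ separates it. An $\mathcal N$-block is a maximal $\mathcal N$-inseparable set of vertices. Structure tree. For a nested separation system $\mathcal N$, define on $\mathcal N$ the equivalence relation: $(A,B)\sim(C,D)$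 iff $(A,B)=(C,D)$ or $(B,A)$ is a predecessor of $(C,D)$ in $(\mathcal N,\le)$ (i.e. $(B,A)<(C,D)$ with no element of $\mathcal N$ strictly between). The structure tree $\mathcal T(\mathcal N)$ has as nodes the equivalence classes $[(A,B)]$ of $\sim$, and as edges the sets $\{(A,B),(B,A)\}$ with $(A,B)\in\mathcal N$, where such an edge joins the nodes $[(A,B)]$ and $[(B,A)]$. Convention: $\mathcal T(\emptyset)$ is the tree with the single node $\emptyset$. For a node $t$ put $V_t=\bigcap\{A\mid(A,B)\in t\}$ (so $V_\emptyset=V(G)$). A node $t$ is a hub node, and $V_t$ a hub, if $V_t=A\cap B$ for some $(A,B)\in t$. Tree-decompositions. A tree-decomposition of $G$ is a pair $(T,\mathcal V)$ of a tree $T$ and a family $\mathcal V=(V_t)_{t\in T}$ of subsets of $V(G)$ (parts) covering $V(G)$, such that every edge of $G$ has both ends in some $V_t$, and $V_{t_1}\cap V_{t_3}\subseteq V_{t_2}$ whenever $t_2$ lies on the $t_1$–$t_3$ path in $T$. The separations induced by it are, for every edge $e$ of $T$ with $T_1,T_2$ the two components of $T-e$, the pairs $(U_1,U_2)$ and $(U_2,U_1)$ where $U_i=\bigcup_{t\in T_i}V_t$. For tree-decompositions write $(\mathcal T_m,\mathcal V_m)\preccurlyeq(\mathcal T_n,\mathcal V_n)$ if $\mathcal T_m$ is a minor of $\mathcal T_n$ and every part $V_t\in\mathcal V_m$ of the first is the union of those parts $V_{t'}$ of the second whose nodes $t'$ were contracted to the node $t$ of $\mathcal T_m$. *)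

theory Defs
  imports "Graph_Theory.Graph_Theory"
begin

text \<open>
  Finite simple graphs are symmetric digraphs (locale \<^locale>\<open>graph\<close>): an undirected edge is
  a pair of mutually inverse arcs.
\<close>

subsection \<open>Separations\<close>

type_synonym 'a sep = "'a set \<times> 'a set"

definition separation :: "('a,'b) pre_digraph \<Rightarrow> 'a sep \<Rightarrow> bool" where
  "separation G = (\<lambda>(A,B). A \<subseteq> verts G \<and> B \<subseteq> verts G \<and> union (G \<restriction> A) (G \<restriction> B) = G)"

definition proper_separation :: "('a,'b) pre_digraph \<Rightarrow> 'a sep \<Rightarrow> bool" where
  "proper_separation G = (\<lambda>(A,B). separation G (A,B) \<and> A - B \<noteq> {} \<and> B - A \<noteq> {})"

definition sep_le :: "'a sep \<Rightarrow> 'a sep \<Rightarrow> bool" where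
  "sep_le = (\<lambda>(A,B) (C,D). A \<subseteq> C \<and> D \<subseteq> B)"

definition sep_less :: "'a sep \<Rightarrow> 'a sep \<Rightarrow> bool" where
  "sep_less s u \<longleftrightarrow> sep_le s u \<and> s \<noteq> u"

definition nested_seps :: "'a sep \<Rightarrow> 'a sep \<Rightarrow> bool" where
  "nested_seps s u \<longleftrightarrow>
     (sep_le s u \<or> sep_le u s) \<or> (sep_le s (prod.swap u) \<or> sep_le (prod.swap u) s)"

definition separation_system :: "('a,'b) pre_digraph \<Rightarrow> 'a sep set \<Rightarrow> bool" where
  "separation_system G N \<longleftrightarrow>
     (\<forall>s\<in>N. proper_separation G s) \<and> (\<forall>s\<in>N. prod.swap s \<in> N)"

definition nested_separation_system :: "('a,'b) pre_digraph \<Rightarrow> 'a sep set \<Rightarrow> bool" where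
  "nested_separation_system G N \<longleftrightarrow>
     separation_system G N \<and> (\<forall>s\<in>N. \<forall>u\<in>N. nested_seps s u)"

definition separates :: "'a sep \<Rightarrow> 'a set \<Rightarrow> bool" where
  "separates = (\<lambda>(A,B) I. I \<inter> (A - B) \<noteq> {} \<and> I \<inter> (B - A) \<noteq> {})"

definition inseparable :: "('a,'b) pre_digraph \<Rightarrow> 'a sep set \<Rightarrow> 'a set \<Rightarrow> bool" where
  "inseparable G N I \<longleftrightarrow> I \<subseteq> verts G \<and> (\<forall>s\<in>N. \<not> separates s I)"

definition is_block :: "('a,'b) pre_digraph \<Rightarrow> 'a sep set \<Rightarrow> 'a set \<Rightarrow> bool" where
  "is_block G N X \<longleftrightarrow>
     inseparable G N X \<and> (\<forall>Y. inseparable G N Y \<and> X \<subseteq> Y \<longrightarrow> Y = X)"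


subsection \<open>The structure tree\<close>

definition predecessor :: "'a sep set \<Rightarrow> 'a sep \<Rightarrow> 'a sep \<Rightarrow> bool" where
  "predecessor N s u \<longleftrightarrow>
     s \<in> N \<and> u \<in> N \<and> sep_less s u \<and> \<not> (\<exists>w\<in>N. sep_less s w \<and> sep_less w u)"

definition sep_equiv :: "'a sep set \<Rightarrow> ('a sep \<times> 'a sep) set" where
  "sep_equiv N = {(s,u). s \<in> N \<and> u \<in> N \<and> (s = u \<or> predecessor N (prod.swap s) u)}"

text \<open>
  The edge \<open>{(A,B), (B,A)}\<close> of the structure tree is represented by the two mutually inverse
  arcs \<open>(A,B)\<close> and \<open>(B,A)\<close>; the arc \<open>(A,B)\<close> leads from the node \<open>[(A,B)]\<close> to
  the node \<open>[(B,A)]\<close>. So two different edges with the same ends would be parallel edges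
  here, not identified with each other.
\<close>

definition structure_tree :: "'a sep set \<Rightarrow> ('a sep set, 'a sep) pre_digraph" where
  "structure_tree N =
     \<lparr> verts = (if N = {} then {{}} else N // sep_equiv N),
       arcs = N,
       tail = (\<lambda>s. sep_equiv N `` {s}),
       head = (\<lambda>s. sep_equiv N `` {prod.swap s}) \<rparr>"

text \<open>
  The intersection with \<^term>\<open>verts G\<close> only matters for the empty node, where it gives
  \<open>V(G)\<close>.
\<close>

definition node_part :: "('a,'b) pre_digraph \<Rightarrow> 'a sep set \<Rightarrow> 'a set" where
  "node_part G t = verts G \<inter> (\<Inter>(A,B)\<in>t. A)"

definition hub_node :: "('a,'b) pre_digraph \<Rightarrow> 'a sep set \<Rightarrow> bool" where
  "hub_node G t \<longleftrightarrow> (\<exists>(A,B)\<in>t. node_part G t = A \<inter> B)"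


subsection \<open>Tree-decompositions\<close>

text \<open>
  The constant \<^const>\<open>tree\<close> cannot be used here: it forbids all directed cycles, and in a
  symmetric digraph an arc followed by its inverse is one, of length 2. In a loopless graph
  without parallel arcs the cycles of length at least 3 are exactly the undirected cycles.
\<close>

definition undirected_tree :: "('n,'e) pre_digraph \<Rightarrow> bool" where
  "undirected_tree T \<longleftrightarrow>
     graph T \<and> connected T \<and> \<not> (\<exists>p. pre_digraph.cycle T p \<and> 3 \<le> length p)"

definition tree_decomposition ::
    "('a,'b) pre_digraph \<Rightarrow> ('n,'e) pre_digraph \<Rightarrow> ('n \<Rightarrow> 'a set) \<Rightarrow> bool" where
  "tree_decomposition G T V \<longleftrightarrow>
     undirected_tree T \<and>
     (\<forall>t\<in>verts T. V t \<subseteq> verts G) \<and>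
     (\<Union>t\<in>verts T. V t) = verts G \<and>
     (\<forall>e\<in>arcs G. \<exists>t\<in>verts T. tail G e \<in> V t \<and> head G e \<in> V t) \<and>
     (\<forall>t1 p t3. pre_digraph.apath T t1 p t3 \<longrightarrow>
        (\<forall>t2\<in>set (pre_digraph.awalk_verts T t1 p). V t1 \<inter> V t3 \<subseteq> V t2))"

text \<open>The undirected edge containing an arc is deleted by deleting both of its arcs.\<close>

definition delete_edge :: "('n,'e) pre_digraph \<Rightarrow> 'e \<Rightarrow> ('n,'e) pre_digraph" where
  "delete_edge T e =
     T \<lparr> arcs := {f \<in> arcs T. arc_to_ends T f \<noteq> (tail T e, head T e) \<and>
                             arc_to_ends T f \<noteq> (head T e, tail T e)} \<rparr>"

text \<open>
  In a symmetric digraph the strongly connected components are the components of the undirected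
  graph. As \<open>C1\<close> and \<open>C2\<close> may be exchanged, both orders of each separation are included.
\<close>

definition induced_separations :: "('n,'e) pre_digraph \<Rightarrow> ('n \<Rightarrow> 'a set) \<Rightarrow> 'a sep set" where
  "induced_separations T V =
     {(\<Union>t\<in>C1. V t, \<Union>t\<in>C2. V t) | e C1 C2.
        e \<in> arcs T \<and> C1 \<noteq> C2 \<and>
        C1 \<in> pre_digraph.sccs_verts (delete_edge T e) \<and>
        C2 \<in> pre_digraph.sccs_verts (delete_edge T e)}"

text \<open>
  \<open>\<beta>\<close> exhibits the simple graph \<open>H\<close> as a minor of \<open>K\<close>: the vertices in the branch set
  \<open>\<beta> x\<close> are those contracted to the vertex \<open>x\<close> of \<open>H\<close>. Branch sets are nonempty because
  \<^const>\<open>connected\<close> excludes the null graph.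
\<close>

definition minor_model ::
    "('m,'d) pre_digraph \<Rightarrow> ('n,'e) pre_digraph \<Rightarrow> ('m \<Rightarrow> 'n set) \<Rightarrow> bool" where
  "minor_model H K \<beta> \<longleftrightarrow>
     (\<forall>x\<in>verts H. \<beta> x \<subseteq> verts K \<and> connected (K \<restriction> \<beta> x)) \<and>
     (\<forall>x\<in>verts H. \<forall>y\<in>verts H. x \<noteq> y \<longrightarrow> \<beta> x \<inter> \<beta> y = {}) \<and>
     (\<forall>d\<in>arcs H. \<exists>e\<in>arcs K. tail K e \<in> \<beta> (tail H d) \<and> head K e \<in> \<beta> (head H d))"

definition decomposition_le ::
    "('m,'d) pre_digraph \<Rightarrow> ('m \<Rightarrow> 'a set) \<Rightarrow> ('n,'e) pre_digraph \<Rightarrow> ('n \<Rightarrow> 'a set) \<Rightarrow> bool" where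
  "decomposition_le T V T' V' \<longleftrightarrow>
     (\<exists>\<beta>. minor_model T T' \<beta> \<and> (\<forall>t\<in>verts T. V t = (\<Union>t'\<in>\<beta> t. V' t')))"

end

theory Submission
  imports Defs
begin

text \<open>
  The proof replaces nodes of the structure tree by orientations of the nested system \<open>N\<close>. A node \<open>t\<close>
  determines the set \<open>O(t)\<close> of all separations in \<open>N\<close> that lie above an element of \<open>t\<close>. Thinking of
  \<open>(A, B)\<close> as an edge of the tree, \<open>(A, B) \<in> O(t)\<close> says that \<open>t\<close> lies on the \<open>A\<close>-side of this edge.
  Three facts make this a complete description of the tree: \<open>O(t)\<close> contains exactly one of \<open>s\<close> and
  its inverse for each \<open>s \<in> N\<close> (\<open>opp_in_orientation_iff\<close>); different nodes have different
  orientations (\<open>orientation_inject\<close>); and crossing the edge \<open>s\<close> changes the orientation in the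
  single place \<open>s\<close> (\<open>orientation_opp_class\<close>).

  Hence one walks from \<open>t\<close> to \<open>t'\<close> by reversing, one at a time, the separations on which \<open>O(t)\<close> and
  \<open>O(t')\<close> differ (\<open>reachable_in_side\<close>), and a walk whose ends differ on \<open>s\<close> has to use the edge \<open>s\<close>
  (\<open>walk_crosses\<close>). The former gives connectedness of the tree, of the two components left by
  deleting an edge, and of the branch sets of the minor for a subsystem, all of which have the form
  \<open>{t. R \<subseteq> O(t)}\<close>. The latter excludes cycles and gives the path property of the parts.

  The parts are controlled by \<open>inseparable_in_part\<close>: an inseparable set \<open>X\<close> lies in the part of a
  node, and this node can be found among those with \<open>R \<subseteq> O(t)\<close>, provided that \<open>X\<close> lies on the left
  of every separation in \<open>R\<close> and \<open>R\<close> is a star, that is, \<open>r \<sqsubseteq> q\<^sup>*\<close> for no \<open>r, q \<in> R\<close>, where \<open>q\<^sup>*\<close>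
  is the inverse of \<open>q\<close>. With \<open>R\<close> empty this yields the covering of vertices and edges and finds
  every block among the parts. With \<open>R = {(A, B)}\<close> it shows that the parts on one side of an edge
  have union \<open>A\<close>. With \<open>R\<close> a node of the tree of a subsystem it shows that the part of this node
  is the union of the parts contracted to it.
\<close>


section \<open>The order on separations and its involution\<close>

notation sep_le (infix "\<sqsubseteq>" 50)
notation sep_less (infix "\<sqsubset>" 50)

abbreviation opp :: "'a sep \<Rightarrow> 'a sep" where
  "opp \<equiv> prod.swap"

lemma sep_le_iff: "s \<sqsubseteq> u \<longleftrightarrow> fst s \<subseteq> fst u \<and> snd u \<subseteq> snd s"
  by (auto simp: sep_le_def split: prod.splits)

lemma sep_le_refl [simp]: "s \<sqsubseteq> s"
  by (simp add: sep_le_iff)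

lemma sep_le_trans: "s \<sqsubseteq> u \<Longrightarrow> u \<sqsubseteq> w \<Longrightarrow> s \<sqsubseteq> w"
  by (auto simp: sep_le_iff)

lemma sep_le_antisym: "s \<sqsubseteq> u \<Longrightarrow> u \<sqsubseteq> s \<Longrightarrow> s = u"
  by (auto simp: sep_le_iff prod_eq_iff)

lemma sep_less_imp_le: "s \<sqsubset> u \<Longrightarrow> s \<sqsubseteq> u"
  by (simp add: sep_less_def)

lemma sep_less_le_trans: "s \<sqsubset> u \<Longrightarrow> u \<sqsubseteq> w \<Longrightarrow> s \<sqsubset> w"
  by (metis sep_less_def sep_le_antisym sep_le_trans)

lemma opp_le_opp [simp]: "opp s \<sqsubseteq> opp u \<longleftrightarrow> u \<sqsubseteq> s"
  by (auto simp: sep_le_iff)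

lemma opp_eq_opp [simp]: "opp s = opp u \<longleftrightarrow> s = u"
  by (auto simp: prod_eq_iff)

lemma opp_less_opp [simp]: "opp s \<sqsubset> opp u \<longleftrightarrow> u \<sqsubset> s"
  by (auto simp: sep_less_def)

lemma opp_le_iff: "opp s \<sqsubseteq> u \<longleftrightarrow> opp u \<sqsubseteq> s"
  by (auto simp: sep_le_iff)

lemma le_opp_iff: "s \<sqsubseteq> opp u \<longleftrightarrow> u \<sqsubseteq> opp s"
  by (auto simp: sep_le_iff)

lemma opp_less_iff: "opp s \<sqsubset> u \<longleftrightarrow> opp u \<sqsubset> s"
  by (auto simp: sep_less_def opp_le_iff)

lemma finite_sep_minimal:
  assumes "finite M" "M \<noteq> {}"
  obtains m where "m \<in> M" "\<And>x. x \<in> M \<Longrightarrow> \<not> x \<sqsubset> m"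
proof -
  have "\<exists>m\<in>M. \<forall>x\<in>M. x \<noteq> m \<longrightarrow> \<not> x \<sqsubset> m"
    using assms
    by (intro Finite_Set.bex_min_element)
       (auto simp: asymp_on_def transp_on_def sep_less_def
             dest: sep_le_antisym intro: sep_le_trans)
  then obtain m where "m \<in> M" "\<forall>x\<in>M. x \<noteq> m \<longrightarrow> \<not> x \<sqsubset> m" by blast
  then show thesis
    using that[of m] unfolding sep_less_def by blast
qed


section \<open>Nodes as orientations\<close>

text \<open>
  Only this much of a nested system of proper separations matters for the shape of its tree;
  properness enters through the last condition alone.
\<close>

locale nested_system =
  fixes N :: "'a sep set"
  assumes finite_N: "finite N"
    and opp_in: "s \<in> N \<Longrightarrow> opp s \<in> N"
    and nested: "s \<in> N \<Longrightarrow> u \<in> N \<Longrightarrow> nested_seps s u"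
    and not_opp_le: "s \<in> N \<Longrightarrow> \<not> opp s \<sqsubseteq> s"

text \<open>
  This is the set of those oriented edges of the tree whose tail is the end nearer to \<open>t\<close>.
\<close>

definition orientation :: "'a sep set \<Rightarrow> 'a sep set \<Rightarrow> 'a sep set" where
  "orientation N t = {s \<in> N. \<exists>u\<in>t. u \<sqsubseteq> s}"

lemma orientation_upclosed:
  "s \<in> orientation N t \<Longrightarrow> s \<sqsubseteq> u \<Longrightarrow> u \<in> N \<Longrightarrow> u \<in> orientation N t"
  by (auto simp: orientation_def intro: sep_le_trans)

lemma orientation_subset: "orientation N t \<subseteq> N"
  by (auto simp: orientation_def)

lemma mem_orientation: "s \<in> orientation N t \<longleftrightarrow> s \<in> N \<and> (\<exists>u\<in>t. u \<sqsubseteq> s)"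
  by (simp add: orientation_def)

definition sep_class :: "'a sep set \<Rightarrow> 'a sep \<Rightarrow> 'a sep set" where
  "sep_class N s = sep_equiv N `` {s}"

abbreviation nodes :: "'a sep set \<Rightarrow> 'a sep set set" where
  "nodes N \<equiv> verts (structure_tree N)"

lemma structure_tree_sel [simp]:
  "arcs (structure_tree N) = N"
  "tail (structure_tree N) s = sep_class N s"
  "head (structure_tree N) s = sep_class N (opp s)"
  by (simp_all add: structure_tree_def sep_class_def)

lemma mem_sep_class: "u \<in> sep_class N s \<longleftrightarrow> s \<in> N \<and> (u = s \<or> predecessor N (opp s) u)"
  by (auto simp: sep_class_def sep_equiv_def predecessor_def)

context nested_system
begin

lemma le_cases:
  assumes "s \<in> N" "u \<in> N"
  obtains "s \<sqsubseteq> u" | "u \<sqsubseteq> s" | "s \<sqsubseteq> opp u" | "opp u \<sqsubseteq> s"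
  using nested[OF assms] by (auto simp: nested_seps_def)

lemma not_le_opp: "s \<in> N \<Longrightarrow> \<not> s \<sqsubseteq> opp s"
  using not_opp_le[of "opp s"] opp_in by auto

text \<open>From \<open>u \<sqsubseteq> s\<close> and \<open>u \<sqsubseteq> opp s\<close> would follow \<open>u \<sqsubseteq> s \<sqsubseteq> opp u\<close>.\<close>

lemma not_below_both: "u \<in> N \<Longrightarrow> u \<sqsubseteq> s \<Longrightarrow> \<not> u \<sqsubseteq> opp s"
  using le_opp_iff[of u s] sep_le_trans[of u s "opp u"] not_le_opp by blast

lemma not_above_both: "u \<in> N \<Longrightarrow> s \<sqsubseteq> u \<Longrightarrow> \<not> opp s \<sqsubseteq> u"
  using opp_le_iff[of s u] sep_le_trans[of "opp u" s u] not_opp_le by blast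

lemma predecessor_below:
  assumes "s \<in> N" "u \<in> N" "s \<sqsubset> u"
  obtains w where "predecessor N s w" "w \<sqsubseteq> u"
proof -
  have "finite {w \<in> N. s \<sqsubset> w \<and> w \<sqsubseteq> u}" "u \<in> {w \<in> N. s \<sqsubset> w \<and> w \<sqsubseteq> u}"
    using finite_N assms by simp_all
  then obtain w where w: "w \<in> {w \<in> N. s \<sqsubset> w \<and> w \<sqsubseteq> u}"
    and min: "\<And>x. x \<in> {w \<in> N. s \<sqsubset> w \<and> w \<sqsubseteq> u} \<Longrightarrow> \<not> x \<sqsubset> w"
    using finite_sep_minimal by blast
  have "predecessor N s w"
    unfolding predecessor_def
    using w min assms by (auto dest: sep_less_imp_le intro: sep_le_trans)
  then show thesis using w that by blast
qed

lemma equiv_sep_equiv: "equiv N (sep_equiv N)"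
proof (rule equivI)
  show "sep_equiv N \<subseteq> N \<times> N" "refl_on N (sep_equiv N)"
    by (auto simp: sep_equiv_def refl_on_def)
  show "sym (sep_equiv N)"
  proof (rule symI)
    fix s u assume "(s, u) \<in> sep_equiv N"
    moreover have "predecessor N (opp u) s" if pred: "predecessor N (opp s) u"
      and "s \<in> N" "u \<in> N"
      unfolding predecessor_def
    proof (intro conjI notI)
      show "opp u \<sqsubset> s" using pred by (simp add: predecessor_def opp_less_iff)
      assume "\<exists>w\<in>N. opp u \<sqsubset> w \<and> w \<sqsubset> s"
      then obtain w where "w \<in> N" "opp u \<sqsubset> w" "w \<sqsubset> s" by blast
      then have "opp w \<in> N" "opp s \<sqsubset> opp w" "opp w \<sqsubset> u"
        using opp_in opp_less_iff opp_less_opp by blast+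
      then show False using pred by (auto simp: predecessor_def)
    qed (use that opp_in in auto)
    ultimately show "(u, s) \<in> sep_equiv N"
      by (auto simp: sep_equiv_def)
  qed
  show "trans (sep_equiv N)"
  proof (rule transI)
    fix s u v assume su: "(s, u) \<in> sep_equiv N" and uv: "(u, v) \<in> sep_equiv N"
    show "(s, v) \<in> sep_equiv N"
    proof (cases "s = u \<or> u = v \<or> s = v")
      case True
      then show ?thesis using su uv by (auto simp: sep_equiv_def)
    next
      case False
      then have N: "s \<in> N" "u \<in> N" "v \<in> N" and "s \<noteq> v"
        and su': "predecessor N (opp s) u" and uv': "predecessor N (opp u) v"
        using su uv by (auto simp: sep_equiv_def)
      have us: "opp u \<sqsubset> s" and uv1: "opp u \<sqsubset> v"
        using su' uv' by (auto simp: predecessor_def opp_less_iff)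
      have no_between: "\<not> (opp s \<sqsubset> w \<and> w \<sqsubset> u)" "\<not> (opp u \<sqsubset> w \<and> w \<sqsubset> v)" if "w \<in> N" for w
        using that su' uv' by (auto simp: predecessor_def)
      have not_uv: "\<not> u \<sqsubseteq> v" and not_us: "\<not> u \<sqsubseteq> s"
        using not_above_both[of v u] not_above_both[of s u] N us uv1
        by (auto dest: sep_less_imp_le)
      \<comment> \<open>\<open>s\<close> and \<open>v\<close> both cover \<open>opp u\<close>, so they are incomparable; the other two ways of being
        nested remain.\<close>
      have "\<not> s \<sqsubseteq> v" "\<not> v \<sqsubseteq> s"
        using no_between(2)[of s] no_between(1)[of "opp v"] us uv1 \<open>s \<noteq> v\<close> N opp_in
        by (auto simp: sep_less_def opp_le_iff)
      moreover have "\<not> s \<sqsubseteq> opp v"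
      proof
        assume "s \<sqsubseteq> opp v"
        then have "v \<sqsubseteq> opp s" by (rule le_opp_iff[THEN iffD1])
        moreover have "opp s \<sqsubseteq> u"
          using su' by (simp add: predecessor_def sep_less_imp_le)
        ultimately have "opp u \<sqsubseteq> u"
          using uv1 sep_less_imp_le sep_le_trans by blast
        then show False using not_opp_le N by blast
      qed
      ultimately have le: "opp s \<sqsubseteq> v"
        using le_cases[OF N(1,3)] opp_le_iff[of s v] by blast
      have "opp s \<noteq> v"
        using not_below_both[OF opp_in[OF N(2)]] us uv1 by (blast dest: sep_less_imp_le)
      with le have less: "opp s \<sqsubset> v" by (simp add: sep_less_def)
      have "\<not> (opp s \<sqsubset> w \<and> w \<sqsubset> v)" if "w \<in> N" for w
      proof
        assume w: "opp s \<sqsubset> w \<and> w \<sqsubset> v"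
        from \<open>w \<in> N\<close> N(2) show False
        proof (cases rule: le_cases)
          case 1
          then show False using w no_between(1)[OF that] not_uv
            unfolding sep_less_def by blast
        next
          case 2
          then show False using w not_uv sep_le_trans sep_less_imp_le by blast
        next
          case 3
          then have "opp s \<sqsubseteq> opp u" using w sep_le_trans sep_less_imp_le by blast
          then show False using not_us by simp
        next
          case 4
          then show False using w no_between(2)[OF that] not_us
            unfolding sep_less_def using opp_le_opp by blast
        qed
      qed
      then have "predecessor N (opp s) v"
        using N opp_in less by (auto simp: predecessor_def)
      then show ?thesis using N by (auto simp: sep_equiv_def)
    qed
  qed
qed

lemma sep_class_self [simp]: "s \<in> N \<Longrightarrow> s \<in> sep_class N s"
  by (simp add: mem_sep_class)

lemma node_cases:
  assumes "t \<in> nodes N"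
  obtains "N = {}" "t = {}" | s where "s \<in> N" "t = sep_class N s"
  using assms by (auto simp: structure_tree_def quotient_def sep_class_def split: if_splits)

lemma sep_class_node: "s \<in> N \<Longrightarrow> sep_class N s \<in> nodes N"
  by (auto simp: structure_tree_def sep_class_def intro: quotientI)

lemma node_subset: "t \<in> nodes N \<Longrightarrow> t \<subseteq> N"
  by (auto elim!: node_cases simp: mem_sep_class predecessor_def)

lemma node_eq_sep_class: "t \<in> nodes N \<Longrightarrow> s \<in> t \<Longrightarrow> t = sep_class N s"
  using equiv_class_eq[OF equiv_sep_equiv]
  by (metis (no_types) Image_singleton_iff empty_iff node_cases sep_class_def)

lemma node_star:
  assumes "t \<in> nodes N" "r \<in> t" "q \<in> t" "r \<noteq> q"
  shows "opp r \<sqsubset> q"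
  using node_eq_sep_class[OF assms(1,2)] assms(3,4) by (auto simp: mem_sep_class predecessor_def)

lemma node_not_le_opp:
  assumes "t \<in> nodes N" "r \<in> t" "q \<in> t"
  shows "\<not> r \<sqsubseteq> opp q"
proof (cases "r = q")
  case True
  then show ?thesis using assms node_subset not_le_opp by blast
next
  case False
  then have "opp q \<sqsubset> r"
    using node_star[OF assms(1,3,2)] by simp
  then show ?thesis
    using sep_le_antisym unfolding sep_less_def by blast
qed

text \<open>
  If \<open>opp s \<sqsubset> u\<close>, finiteness provides a \<open>w \<sqsubseteq> u\<close> of which \<open>opp s\<close> is a predecessor. By definition of
  the equivalence, this \<open>w\<close> belongs to the class of \<open>s\<close>.
\<close>

lemma orientation_sep_class:
  assumes "s \<in> N"
  shows "orientation N (sep_class N s) = {u \<in> N. s \<sqsubseteq> u \<or> opp s \<sqsubset> u}"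
proof (intro equalityI subsetI)
  fix u assume "u \<in> orientation N (sep_class N s)"
  then obtain w where "u \<in> N" "w \<in> sep_class N s" "w \<sqsubseteq> u"
    unfolding mem_orientation by blast
  moreover from this(2) have "w = s \<or> opp s \<sqsubset> w"
    unfolding mem_sep_class predecessor_def by (elim conjE disjE) simp_all
  ultimately
  show "u \<in> {u \<in> N. s \<sqsubseteq> u \<or> opp s \<sqsubset> u}"
    using sep_less_le_trans[of "opp s" w u] by (elim disjE) simp_all
next
  fix u assume "u \<in> {u \<in> N. s \<sqsubseteq> u \<or> opp s \<sqsubset> u}"
  then have "u \<in> N" "s \<sqsubseteq> u \<or> opp s \<sqsubset> u" by simp_all
  from this(2) obtain w where "w \<in> sep_class N s" "w \<sqsubseteq> u"
  proof
    assume "s \<sqsubseteq> u"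
    then show thesis using that[of s] assms by simp
  next
    assume "opp s \<sqsubset> u"
    then obtain w where "predecessor N (opp s) w" "w \<sqsubseteq> u"
      using predecessor_below[OF opp_in[OF assms] \<open>u \<in> N\<close>] by blast
    then show thesis using that[of w] assms by (simp add: mem_sep_class)
  qed
  then show "u \<in> orientation N (sep_class N s)"
    unfolding mem_orientation using \<open>u \<in> N\<close> by blast
qed

text \<open>
  At least one of \<open>s\<close> and \<open>opp s\<close> is chosen because \<open>s\<close> is nested with a representative of \<open>t\<close>. If
  \<open>p \<sqsubseteq> s\<close> and \<open>q \<sqsubseteq> opp s\<close> were both possible for \<open>p, q \<in> t\<close>, then \<open>p \<sqsubseteq> opp q\<close>, against the star
  shape of a node.
\<close>

lemma opp_in_orientation_iff:
  assumes "t \<in> nodes N" "s \<in> N"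
  shows "opp s \<in> orientation N t \<longleftrightarrow> s \<notin> orientation N t"
  using assms(1)
proof (cases rule: node_cases)
  case 1
  then show ?thesis using assms by simp
next
  case (2 u)
  have "opp s \<in> N" using assms opp_in by simp
  show ?thesis
  proof
    assume "s \<notin> orientation N t"
    then have "\<not> u \<sqsubseteq> s" "\<not> opp u \<sqsubset> s"
      using 2 assms by (auto simp: orientation_sep_class)
    then have "u \<sqsubseteq> opp s \<or> opp u \<sqsubset> opp s"
      using le_cases[OF 2(1) assms(2)]
      using opp_le_iff[of s u] opp_less_opp sep_le_refl unfolding sep_less_def
      by (metis swap_swap)
    then show "opp s \<in> orientation N t"
      using 2 \<open>opp s \<in> N\<close> by (simp add: orientation_sep_class del: opp_less_opp)
  next
    assume *: "opp s \<in> orientation N t"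
    show "s \<notin> orientation N t"
    proof
      assume "s \<in> orientation N t"
      with * obtain p q where pq: "p \<in> t" "q \<in> t" "p \<sqsubseteq> s" "q \<sqsubseteq> opp s"
        by (auto simp: orientation_def)
      then have "p \<sqsubseteq> opp q" by (metis le_opp_iff sep_le_trans)
      then show False using node_not_le_opp[OF assms(1) pq(1,2)] by simp
    qed
  qed
qed

lemma orientation_inject:
  assumes "t \<in> nodes N" "t' \<in> nodes N" "orientation N t \<subseteq> orientation N t'"
  shows "t = t'"
proof -
  have eq: "orientation N t = orientation N t'"
    using assms opp_in_orientation_iff orientation_subset by blast
  show ?thesis
    using assms(1)
  proof (cases rule: node_cases)
    case 1
    then show ?thesis using assms(2) by (auto simp: structure_tree_def)
  next
    case (2 s)
    \<comment> \<open>A node consists of minimal elements of its orientation.\<close>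
    then have "s \<in> t" "s \<in> orientation N t'"
      using eq orientation_sep_class by auto
    then obtain u where u: "u \<in> t'" "u \<sqsubseteq> s" by (auto simp: orientation_def)
    then have "u \<in> orientation N t"
      using eq node_subset[OF assms(2)] sep_le_refl unfolding orientation_def by blast
    then obtain v where v: "v \<in> t" "v \<sqsubseteq> u" by (auto simp: orientation_def)
    have "v = s"
    proof (rule ccontr)
      assume "v \<noteq> s"
      then have "opp v \<sqsubseteq> s"
        using node_star[OF assms(1) v(1) \<open>s \<in> t\<close>] by (simp add: sep_less_imp_le)
      then show False
        using not_above_both[of s v] \<open>s \<in> N\<close> sep_le_trans[OF v(2) u(2)] by simp
    qed
    then have "u = s" using u v sep_le_antisym by blast
    then show ?thesis
      using node_eq_sep_class[OF assms(1) \<open>s \<in> t\<close>] node_eq_sep_class[OF assms(2), of s] u by simp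
  qed
qed

lemma orientation_opp_class:
  assumes "s \<in> N"
  shows "orientation N (sep_class N (opp s)) =
    insert (opp s) (orientation N (sep_class N s) - {s})"
proof -
  have "opp s \<sqsubseteq> u \<or> s \<sqsubset> u \<longleftrightarrow> u = opp s \<or> (s \<sqsubseteq> u \<or> opp s \<sqsubset> u) \<and> u \<noteq> s" for u
    using not_opp_le[OF assms] unfolding sep_less_def
    by (cases "u = s"; cases "u = opp s") (simp_all add: disj_commute)
  then have "{u \<in> N. opp s \<sqsubseteq> u \<or> s \<sqsubset> u} =
      insert (opp s) ({u \<in> N. s \<sqsubseteq> u \<or> opp s \<sqsubset> u} - {s})"
    using opp_in[OF assms] by blast
  then show ?thesis
    using orientation_sep_class[OF assms] orientation_sep_class[OF opp_in[OF assms]] by simp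
qed

end

section \<open>The structure tree is a tree\<close>

text \<open>
  For \<open>R = {s}\<close> these are the nodes of one of the components left by deleting the edge \<open>s\<close>; in
  general they form the intersection of such components.
\<close>

abbreviation side :: "'a sep set \<Rightarrow> 'a sep set \<Rightarrow> 'a sep set set" where
  "side N R \<equiv> {t \<in> nodes N. R \<subseteq> orientation N t}"

context nested_system
begin

lemma self_in_orientation: "s \<in> N \<Longrightarrow> s \<in> orientation N (sep_class N s)"
  by (simp add: orientation_sep_class)

lemma not_in_orientation_opp: "s \<in> N \<Longrightarrow> s \<notin> orientation N (sep_class N (opp s))"
  using opp_in_orientation_iff[of "sep_class N (opp s)" s] sep_class_node self_in_orientation
    opp_in by blast

lemma sep_class_ends_inject:
  assumes "s \<in> N" "u \<in> N" "sep_class N s = sep_class N u"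
    "sep_class N (opp s) = sep_class N (opp u)"
  shows "s = u"
proof (rule ccontr)
  assume "s \<noteq> u"
  have "opp s \<sqsubset> u"
    using node_star[OF sep_class_node[OF assms(1)], of s u] sep_class_self[OF assms(1)]
      sep_class_self[OF assms(2)] assms(3) \<open>s \<noteq> u\<close> by simp
  moreover have "opp (opp s) \<sqsubset> opp u"
    using node_star[OF sep_class_node[OF opp_in[OF assms(1)]], of "opp s" "opp u"]
      sep_class_self[OF opp_in[OF assms(1)]] sep_class_self[OF opp_in[OF assms(2)]] assms(4)
      \<open>s \<noteq> u\<close> by simp
  then have "s \<sqsubseteq> opp u" by (simp add: sep_less_imp_le)
  then have "u \<sqsubseteq> opp s" by (rule le_opp_iff[THEN iffD1])
  ultimately show False
    using sep_le_antisym unfolding sep_less_def by blast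
qed

lemma graph_structure_tree: "graph (structure_tree N)"
proof
  show "finite (nodes N)"
    using finite_N by (auto simp: structure_tree_def quotient_def)
  show "finite (arcs (structure_tree N))"
    using finite_N by simp
  show "symmetric (structure_tree N)"
    unfolding symmetric_conv using opp_in by (metis structure_tree_sel swap_swap)
next
  fix s assume s: "s \<in> arcs (structure_tree N)"
  then show "tail (structure_tree N) s \<in> nodes N" "head (structure_tree N) s \<in> nodes N"
    using sep_class_node opp_in by simp_all
  show "tail (structure_tree N) s \<noteq> head (structure_tree N) s"
    using s self_in_orientation not_in_orientation_opp structure_tree_sel by metis
next
  fix s u
  assume "s \<in> arcs (structure_tree N)" "u \<in> arcs (structure_tree N)"
    "arc_to_ends (structure_tree N) s = arc_to_ends (structure_tree N) u"
  then show "s = u"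
    using sep_class_ends_inject by (simp add: arc_to_ends_def)
qed

text \<open>
  As long as \<open>t1 \<noteq> t2\<close>, some \<open>w \<in> t1\<close> is not chosen by \<open>t2\<close>. Crossing the edge \<open>w\<close> changes nothing
  but the choice on this edge, so the number of disagreements drops, while the elements of \<open>R\<close>, on
  which \<open>t1\<close> and \<open>t2\<close> agree, remain chosen.
\<close>

lemma reachable_in_side:
  assumes "t1 \<in> side N R" "t2 \<in> side N R"
  shows "t1 \<rightarrow>\<^sup>*\<^bsub>structure_tree N \<restriction> side N R\<^esub> t2"
  using assms(1)
proof (induction "card (orientation N t1 - orientation N t2)" arbitrary: t1 rule: less_induct)
  case less
  interpret T: graph "structure_tree N" by (rule graph_structure_tree)
  interpret TR: wf_digraph "structure_tree N \<restriction> side N R" ..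
  show ?case
  proof (cases "orientation N t1 \<subseteq> orientation N t2")
    case True
    then have "t1 = t2" using orientation_inject less.prems assms(2) by blast
    then show ?thesis using less.prems TR.reachable_refl[of t1] by simp
  next
    case False
    then obtain v where v: "v \<in> orientation N t1" "v \<notin> orientation N t2" by blast
    then obtain w where w: "w \<in> t1" "w \<sqsubseteq> v" by (auto simp: mem_orientation)
    have "w \<in> N" using w less.prems node_subset by blast
    then have w2: "w \<notin> orientation N t2"
      using v w orientation_upclosed orientation_subset by blast
    have t1: "t1 = sep_class N w" using node_eq_sep_class less.prems w by blast
    define t where "t = sep_class N (opp w)"
    have t: "t \<in> nodes N" using sep_class_node opp_in \<open>w \<in> N\<close> t_def by blast
    have O: "orientation N t = insert (opp w) (orientation N t1 - {w})"
      using orientation_opp_class \<open>w \<in> N\<close> t1 t_def by blast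
    have "opp w \<in> orientation N t2"
      using opp_in_orientation_iff assms(2) \<open>w \<in> N\<close> w2 by blast
    then have "orientation N t - orientation N t2 \<subseteq> orientation N t1 - orientation N t2"
      "w \<notin> orientation N t"
      using O w2 by auto
    moreover have "w \<in> orientation N t1 - orientation N t2"
      using self_in_orientation[OF \<open>w \<in> N\<close>] t1 w2 by simp
    ultimately have "orientation N t - orientation N t2 \<subset> orientation N t1 - orientation N t2"
      by blast
    then have "card (orientation N t - orientation N t2) < card (orientation N t1 - orientation N t2)"
      using finite_N orientation_subset by (meson finite_Diff finite_subset psubset_card_mono)
    moreover have side: "t \<in> side N R"
      using t O less.prems assms(2) w2 by blast
    ultimately have "t \<rightarrow>\<^sup>*\<^bsub>structure_tree N \<restriction> side N R\<^esub> t2"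
      using less.hyps by blast
    moreover have "t1 \<rightarrow>\<^bsub>structure_tree N \<restriction> side N R\<^esub> t"
      using \<open>w \<in> N\<close> less.prems side
      by (intro TR.dominatesI[of w]) (simp_all add: arc_to_ends_def t1 t_def)
    ultimately show ?thesis by (rule TR.adj_reachable_trans[rotated])
  qed
qed

lemma connected_side:
  assumes "side N R \<noteq> {}"
  shows "connected (structure_tree N \<restriction> side N R)"
proof -
  interpret T: graph "structure_tree N" by (rule graph_structure_tree)
  interpret TR: wf_digraph "structure_tree N \<restriction> side N R" ..
  show ?thesis
    using assms reachable_in_side by (intro TR.connectedI TR.reachable_mk_symmetricI) simp_all
qed

lemma arc_changes_orientation:
  assumes "w \<in> N" "s \<in> orientation N (sep_class N (opp w))" "s \<notin> orientation N (sep_class N w)"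
  shows "w = opp s"
  using assms orientation_opp_class[OF assms(1)] by auto

lemma walk_crosses:
  assumes "pre_digraph.awalk (structure_tree N) t1 p t2"
    and "s \<notin> orientation N t1" "s \<in> orientation N t2"
  shows "opp s \<in> set p"
proof -
  interpret T: graph "structure_tree N" by (rule graph_structure_tree)
  show ?thesis
    using assms
  proof (induction p arbitrary: t1)
    case Nil
    then show ?case by (simp add: T.awalk_Nil_iff)
  next
    case (Cons w p)
    then show ?case
      using arc_changes_orientation[of w s] by (auto simp: T.awalk_Cons_iff)
  qed
qed

text \<open>
  A closed walk through the arc \<open>s\<close> has to return to the side that it left, which it can only do
  along \<open>opp s\<close>; in a cycle there is then no room for a third arc.
\<close>

lemma undirected_tree_structure_tree: "undirected_tree (structure_tree N)"
proof -
  interpret T: graph "structure_tree N" by (rule graph_structure_tree)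
  have "side N {} = nodes N" by simp
  moreover have "nodes N \<noteq> {}"
    using sep_class_node by (cases "N = {}") (auto simp: structure_tree_def)
  moreover have "structure_tree N \<restriction> nodes N = structure_tree N"
    using sep_class_node opp_in by (auto intro!: pre_digraph.equality)
  ultimately have "connected (structure_tree N)"
    using connected_side[of "{}"] by simp
  moreover have False if "T.cycle p" and len: "3 \<le> length p" for p
  proof -
    obtain t where t: "T.awalk t p t" "distinct (tl (T.awalk_verts t p))" "p \<noteq> []"
      using \<open>T.cycle p\<close> by (auto simp: T.cycle_def)
    then obtain s q where p: "p = s # q" by (cases p) auto
    have "s \<in> N" and q: "T.apath (sep_class N (opp s)) q (sep_class N s)"
      using t p by (auto simp: T.awalk_Cons_iff T.apath_def)
    then have "opp s \<in> set q"
      using walk_crosses[OF T.awalkI_apath[OF q]] self_in_orientation not_in_orientation_opp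
      by blast
    then obtain q1 q2 where q12: "q = q1 @ opp s # q2" by (meson split_list)
    have "T.apath (sep_class N (opp s)) q1 (sep_class N (opp s))"
      "T.apath (sep_class N s) q2 (sep_class N s)"
      using q unfolding q12 by (auto simp: T.apath_append_iff T.apath_Cons_iff)
    then have "q1 = []" "q2 = []"
      using T.apath_nonempty_ends by blast+
    then show False using len p q12 by simp
  qed
  ultimately show ?thesis
    unfolding undirected_tree_def using graph_structure_tree by blast
qed


section \<open>Deleting an edge\<close>

lemma arcs_delete_edge:
  assumes "s \<in> N"
  shows "arcs (delete_edge (structure_tree N) s) = N - {s, opp s}"
proof -
  have "sep_class N u = sep_class N s \<and> sep_class N (opp u) = sep_class N (opp s) \<longleftrightarrow> u = s"
    "sep_class N u = sep_class N (opp s) \<and> sep_class N (opp u) = sep_class N s \<longleftrightarrow> u = opp s"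
    if "u \<in> N" for u
    using sep_class_ends_inject[OF that assms] sep_class_ends_inject[OF that opp_in[OF assms]]
    by auto
  then show ?thesis
    unfolding delete_edge_def arc_to_ends_def by auto
qed

text \<open>
  The walks of \<open>reachable_in_side\<close> avoid the deleted edge, whose ends lie on different sides, and
  every other arc joins two nodes that agree on \<open>s\<close>.
\<close>

lemma sccs_verts_delete_edge:
  assumes "s \<in> N"
  shows "pre_digraph.sccs_verts (delete_edge (structure_tree N) s) = {side N {s}, side N {opp s}}"
proof -
  define D where "D = delete_edge (structure_tree N) s"
  have D: "verts D = nodes N" "arcs D = N - {s, opp s}"
    "\<And>u. tail D u = sep_class N u" "\<And>u. head D u = sep_class N (opp u)"
    using arcs_delete_edge[OF assms] by (simp_all add: D_def delete_edge_def)
  interpret D: wf_digraph D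
    by unfold_locales (use D sep_class_node opp_in in auto)
  have inside: "t1 \<rightarrow>\<^sup>*\<^bsub>D\<^esub> t2"
    if u: "u = s \<or> u = opp s" and t: "t1 \<in> side N {u}" "t2 \<in> side N {u}" for u t1 t2
  proof -
    have "u \<in> N" using u assms opp_in by blast
    then have "sep_class N (opp u) \<notin> side N {u}"
      using not_in_orientation_opp by blast
    then have "arcs (structure_tree N \<restriction> side N {u}) \<subseteq> N - {u, opp u}"
      unfolding induce_subgraph_arcs structure_tree_sel by blast
    also have "\<dots> = arcs D"
      using u unfolding D(2) by (elim disjE) (simp_all add: insert_commute)
    finally have sub: "arcs (structure_tree N \<restriction> side N {u}) \<subseteq> arcs D" .
    have "arc_to_ends (structure_tree N \<restriction> side N {u}) = arc_to_ends D"
      by (rule ext) (simp add: arc_to_ends_def D(3,4))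
    with sub have "arcs_ends (structure_tree N \<restriction> side N {u}) \<subseteq> arcs_ends D"
      unfolding arcs_ends_def by (simp add: image_mono del: induce_subgraph_arcs)
    moreover have "side N {u} \<subseteq> verts D"
      unfolding D(1) by blast
    ultimately show ?thesis
      using reachable_in_side[OF t] unfolding reachable_def induce_subgraph_verts
      by (rule rtrancl_on_mono)
  qed
  have closed: "t2 \<in> side N {u}"
    if u: "u = s \<or> u = opp s" and "t1 \<in> side N {u}" "t1 \<rightarrow>\<^sup>*\<^bsub>D\<^esub> t2" for u t1 t2
    using that(3)
  proof (induction rule: D.reachable_induct)
    case base
    then show ?case using that by simp
  next
    case (step x y)
    from step.hyps(2) obtain w where "w \<in> arcs D" "tail D w = x" "head D w = y"
      by (rule reachableE)
    then have w: "w \<in> N" "w \<noteq> s" "w \<noteq> opp s" "x = sep_class N w" "y = sep_class N (opp w)"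
      unfolding D(2-4) by simp_all
    have "w \<noteq> u" using u w by blast
    moreover have "u \<in> orientation N x" using step.IH by simp
    ultimately have "u \<in> orientation N y"
      unfolding w(4,5) orientation_opp_class[OF w(1)] by simp
    then show ?case
      using sep_class_node[OF opp_in[OF w(1)]] w(5) by simp
  qed
  have scc: "D.scc_of t = side N {u}"
    if "u = s \<or> u = opp s" "t \<in> side N {u}" for u t
    unfolding D.scc_of_def using inside[OF that(1)] closed[OF that] that(2) by blast
  have nodes: "nodes N = side N {s} \<union> side N {opp s}"
    using opp_in_orientation_iff[OF _ assms] by blast
  have ends: "sep_class N s \<in> side N {s}" "sep_class N (opp s) \<in> side N {opp s}"
    using assms opp_in[OF assms] sep_class_node self_in_orientation by simp_all
  have image: "D.scc_of ` side N {u} = {side N {u}}"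
    if "u = s \<or> u = opp s" "sep_class N u \<in> side N {u}" for u
  proof -
    have "D.scc_of ` side N {u} = (\<lambda>_. side N {u}) ` side N {u}"
      by (rule image_cong[OF refl scc[OF that(1)]])
    then show ?thesis using image_constant[OF that(2)] by (rule trans)
  qed
  have "D.scc_of ` nodes N = D.scc_of ` side N {s} \<union> D.scc_of ` side N {opp s}"
    by (subst nodes) (rule image_Un)
  also have "\<dots> = {side N {s}, side N {opp s}}"
    unfolding image[OF disjI1[OF refl] ends(1)] image[OF disjI2[OF refl] ends(2)]
    by (rule insert_is_Un[symmetric])
  finally have "D.scc_of ` nodes N = {side N {s}, side N {opp s}}" .
  then show ?thesis
    using D.sccs_verts_conv_scc_of D(1) D_def by simp
qed

end


section \<open>The parts of the decomposition\<close>

lemma node_part_eq: "node_part G t = {x \<in> verts G. \<forall>s\<in>t. x \<in> fst s}"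
  by (auto simp: node_part_def)

locale nested_separations =
  fixes G :: "('a,'b) pre_digraph" and N :: "'a sep set"
  assumes graph: "graph G"
    and nested_system: "nested_separation_system G N"
begin

lemma separationD:
  assumes "s \<in> N"
  shows "fst s \<union> snd s = verts G" "\<not> fst s \<subseteq> snd s" "\<not> snd s \<subseteq> fst s"
    and "e \<in> arcs G \<Longrightarrow> {tail G e, head G e} \<subseteq> fst s \<or> {tail G e, head G e} \<subseteq> snd s"
proof -
  obtain A B where s: "s = (A, B)" by (cases s)
  have "proper_separation G s"
    using assms nested_system
    by (simp add: nested_separation_system_def separation_system_def)
  then have un: "union (G \<restriction> A) (G \<restriction> B) = G" and ne: "A - B \<noteq> {}" "B - A \<noteq> {}"
    by (simp_all add: s proper_separation_def separation_def)
  have V: "A \<union> B = verts G" and E: "arcs (G \<restriction> A) \<union> arcs (G \<restriction> B) = arcs G"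
    using arg_cong[OF un, of verts] arg_cong[OF un, of arcs] by (simp_all add: union_def)
  show "fst s \<union> snd s = verts G" "\<not> fst s \<subseteq> snd s" "\<not> snd s \<subseteq> fst s"
    using V ne by (auto simp: s)
  show "{tail G e, head G e} \<subseteq> fst s \<or> {tail G e, head G e} \<subseteq> snd s" if "e \<in> arcs G"
    using that E by (auto simp: s)
qed

sublocale nested_system N
proof
  interpret graph G by (rule graph)
  have "N \<subseteq> Pow (verts G) \<times> Pow (verts G)"
    using separationD(1) by (fastforce simp: mem_Times_iff)
  then show "finite N"
    by (rule finite_subset) simp
  show "opp s \<in> N" if "s \<in> N" for s
    using that nested_system
    by (simp add: nested_separation_system_def separation_system_def)
  show "nested_seps s u" if "s \<in> N" "u \<in> N" for s u
    using that nested_system by (simp add: nested_separation_system_def)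
  show "\<not> opp s \<sqsubseteq> s" if "s \<in> N" for s
    using separationD(3)[OF that] by (simp add: sep_le_iff)
qed

lemma inseparable_iff:
  "inseparable G N X \<longleftrightarrow> X \<subseteq> verts G \<and> (\<forall>s\<in>N. X \<subseteq> fst s \<or> X \<subseteq> snd s)"
proof -
  have "\<not> separates s X \<longleftrightarrow> X \<subseteq> fst s \<or> X \<subseteq> snd s" if "s \<in> N" "X \<subseteq> verts G" for s
  proof -
    obtain A B where s: "s = (A, B)" by (cases s)
    have "X \<subseteq> A \<union> B"
      using separationD(1)[OF that(1)] that(2) by (simp add: s)
    then show ?thesis
      unfolding s separates_def by auto
  qed
  then show ?thesis
    unfolding inseparable_def by blast
qed

lemma node_part_subset: "s \<in> orientation N t \<Longrightarrow> node_part G t \<subseteq> fst s"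
  by (auto simp: mem_orientation sep_le_iff node_part_eq)

lemma inseparable_node_part:
  assumes "t \<in> nodes N"
  shows "inseparable G N (node_part G t)"
  unfolding inseparable_iff
proof (intro conjI ballI)
  fix s assume "s \<in> N"
  then have "s \<in> orientation N t \<or> opp s \<in> orientation N t"
    using opp_in_orientation_iff[OF assms] by blast
  then show "node_part G t \<subseteq> fst s \<or> node_part G t \<subseteq> snd s"
    using node_part_subset[of s] node_part_subset[of "opp s"] by auto
qed (simp add: node_part_eq)

text \<open>
  A separation \<open>u\<close> that is minimal among those with \<open>X\<close> on their left side represents a node whose
  part contains \<open>X\<close>: any other element \<open>w\<close> of the node satisfies \<open>opp w \<sqsubset> u\<close>, so \<open>X\<close> is not on the
  left of \<open>opp w\<close>. To land among the nodes that choose all of \<open>R\<close>, only those separations compete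
  that are not below the inverse of a member of \<open>R\<close>. The members of \<open>R\<close> compete, because \<open>R\<close> is a
  star, so none of them lies strictly below \<open>u\<close>. If \<open>opp w\<close> is excluded from the competition by
  \<open>r \<in> R\<close>, then \<open>r \<sqsubseteq> w\<close>, and \<open>X\<close> is on the left of \<open>w\<close> because it is on the left of \<open>r\<close>.
\<close>

lemma inseparable_in_part:
  assumes X: "inseparable G N X"
    and R: "R \<subseteq> N" "\<And>r. r \<in> R \<Longrightarrow> X \<subseteq> fst r"
    and star: "\<And>r q. r \<in> R \<Longrightarrow> q \<in> R \<Longrightarrow> \<not> r \<sqsubseteq> opp q"
  obtains t where "t \<in> side N R" "X \<subseteq> node_part G t"
proof (cases "N = {}")
  case True
  then show thesis
    using that[of "{}"] R(1) X by (simp add: structure_tree_def node_part_eq inseparable_def)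
next
  case False
  define M where "M = {u \<in> N. X \<subseteq> fst u \<and> (\<forall>r\<in>R. \<not> u \<sqsubseteq> opp r)}"
  have "R \<subseteq> M" unfolding M_def using R star by blast
  have "finite M" unfolding M_def using finite_N by simp
  moreover have "M \<noteq> {}"
  proof (cases "R = {}")
    case True
    obtain s where "s \<in> N" using False by blast
    then have "s \<in> M \<or> opp s \<in> M"
      using X opp_in True by (simp add: inseparable_iff M_def)
    then show ?thesis by blast
  qed (use \<open>R \<subseteq> M\<close> in blast)
  ultimately obtain u where u: "u \<in> M" and min: "\<And>v. v \<in> M \<Longrightarrow> \<not> v \<sqsubset> u"
    by (rule finite_sep_minimal) blast
  have "u \<in> N" and Xu: "X \<subseteq> fst u" and uR: "\<And>r. r \<in> R \<Longrightarrow> \<not> u \<sqsubseteq> opp r"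
    using u unfolding M_def by blast+
  have "r \<in> orientation N (sep_class N u)" if "r \<in> R" for r
  proof -
    have "r \<in> N" "\<not> r \<sqsubset> u" using that R(1) \<open>R \<subseteq> M\<close> min by blast+
    from \<open>u \<in> N\<close> \<open>r \<in> N\<close> have "u \<sqsubseteq> r \<or> opp u \<sqsubset> r"
    proof (cases rule: le_cases)
      case 2
      then show ?thesis using \<open>\<not> r \<sqsubset> u\<close> unfolding sep_less_def by auto
    next
      case 4
      then have "opp u \<sqsubseteq> r" using opp_le_iff[of r u] by blast
      moreover have "opp u \<noteq> r" using uR[OF that] by auto
      ultimately show ?thesis by (simp add: sep_less_def)
    qed (use uR[OF that] in simp_all)
    then show ?thesis
      using \<open>r \<in> N\<close> orientation_sep_class[OF \<open>u \<in> N\<close>] by simp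
  qed
  then have "sep_class N u \<in> side N R"
    using sep_class_node[OF \<open>u \<in> N\<close>] by blast
  moreover have "X \<subseteq> fst w" if w: "w \<in> sep_class N u" for w
  proof (cases "w = u")
    case False
    then have "w \<in> N" "opp u \<sqsubset> w"
      using w unfolding mem_sep_class predecessor_def by blast+
    then have "opp w \<sqsubset> u" using opp_less_iff by blast
    show ?thesis
    proof (cases "X \<subseteq> fst w")
      case False
      then have "X \<subseteq> fst (opp w)"
        using X \<open>w \<in> N\<close> unfolding inseparable_iff by auto
      moreover have "opp w \<notin> M" using min \<open>opp w \<sqsubset> u\<close> by blast
      ultimately obtain r where "r \<in> R" "r \<sqsubseteq> w"
        unfolding M_def using opp_in[OF \<open>w \<in> N\<close>] opp_le_opp by blast
      then show ?thesis using R(2)[of r] unfolding sep_le_iff by blast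
    qed
  qed (use Xu in simp)
  then have "X \<subseteq> node_part G (sep_class N u)"
    using X unfolding node_part_eq inseparable_def by blast
  ultimately show thesis by (rule that)
qed

lemma union_node_parts:
  assumes "R \<subseteq> N" "\<And>r q. r \<in> R \<Longrightarrow> q \<in> R \<Longrightarrow> \<not> r \<sqsubseteq> opp q"
  shows "(\<Union>t\<in>side N R. node_part G t) = {x \<in> verts G. \<forall>r\<in>R. x \<in> fst r}"
proof (intro equalityI subsetI)
  fix x assume x: "x \<in> {x \<in> verts G. \<forall>r\<in>R. x \<in> fst r}"
  have "inseparable G N {x}"
    using x separationD(1) unfolding inseparable_iff by blast
  then obtain t where "t \<in> side N R" "{x} \<subseteq> node_part G t"
    using assms x by (rule_tac inseparable_in_part[of "{x}" R]) auto
  then show "x \<in> (\<Union>t\<in>side N R. node_part G t)" by blast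
next
  fix x assume "x \<in> (\<Union>t\<in>side N R. node_part G t)"
  then obtain t where t: "R \<subseteq> orientation N t" "x \<in> node_part G t" by blast
  then show "x \<in> {x \<in> verts G. \<forall>r\<in>R. x \<in> fst r}"
    using node_part_subset[of _ t] unfolding node_part_eq by blast
qed

text \<open>
  If \<open>x\<close> lies in the parts of both ends of a path, but not in that of an inner node \<open>t2\<close>, some
  \<open>s \<in> t2\<close> has \<open>x\<close> outside its left side. The path then uses the edge \<open>s\<close> both before and after \<open>t2\<close>,
  and so repeats a node.
\<close>

lemma node_part_path:
  assumes path: "pre_digraph.apath (structure_tree N) t1 p t3"
    and t2: "t2 \<in> set (pre_digraph.awalk_verts (structure_tree N) t1 p)"
  shows "node_part G t1 \<inter> node_part G t3 \<subseteq> node_part G t2"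
proof
  interpret T: graph "structure_tree N" by (rule graph_structure_tree)
  fix x assume x: "x \<in> node_part G t1 \<inter> node_part G t3"
  obtain p1 p2 where p: "p = p1 @ p2" and walks: "T.awalk t1 p1 t2" "T.awalk t2 p2 t3"
    using T.awalk_decomp[OF T.awalkI_apath[OF path] t2] by blast
  have "t1 \<in> nodes N" "t2 \<in> nodes N" "t3 \<in> nodes N"
    using walks T.awalk_hd_in_verts T.awalk_last_in_verts by blast+
  have "x \<in> fst s" if "s \<in> t2" for s
  proof (rule ccontr)
    assume "x \<notin> fst s"
    have "s \<in> N" using node_subset \<open>t2 \<in> nodes N\<close> that by blast
    have O2: "s \<in> orientation N t2"
      using \<open>s \<in> N\<close> that sep_le_refl unfolding mem_orientation by blast
    have O13: "s \<notin> orientation N t1" "s \<notin> orientation N t3"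
      using node_part_subset[of s] x \<open>x \<notin> fst s\<close> by blast+
    have "opp s \<in> set p1"
      using walk_crosses[OF walks(1) O13(1) O2] .
    moreover have "opp (opp s) \<in> set p2"
    proof (rule walk_crosses[OF walks(2)])
      show "opp s \<notin> orientation N t2" "opp s \<in> orientation N t3"
        using O2 O13 opp_in_orientation_iff \<open>t2 \<in> nodes N\<close> \<open>t3 \<in> nodes N\<close> \<open>s \<in> N\<close> by blast+
    qed
    ultimately have in1: "sep_class N (opp s) \<in> set (T.awalk_verts t1 p1)"
      and in2: "sep_class N (opp s) \<in> set (T.awalk_verts t2 p2)"
      using T.awalk_verts_arc1[of "opp s" p1 t1] T.awalk_verts_arc2[OF walks(2), of s]
      by simp_all
    have "sep_class N (opp s) \<noteq> t2"
      using O2 not_in_orientation_opp[OF \<open>s \<in> N\<close>] by blast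
    moreover have "T.awalk_verts t2 p2 = t2 # tl (T.awalk_verts t2 p2)"
      using T.awhd_of_awalk[OF walks(2)] T.awalk_verts_non_Nil list.collapse by metis
    ultimately have "sep_class N (opp s) \<in> set (tl (T.awalk_verts t2 p2))"
      using in2 by (metis set_ConsD)
    then show False
      using T.apath_decomp_disjoint[OF path p in1] T.awlast_of_awalk[OF walks(1)]
        T.awalkE'[OF walks(1)] by metis
  qed
  then show "x \<in> node_part G t2"
    using x unfolding node_part_eq by blast
qed

lemma tree_decomposition_structure_tree:
  "tree_decomposition G (structure_tree N) (node_part G)"
  unfolding tree_decomposition_def
proof (intro conjI allI impI ballI)
  show "undirected_tree (structure_tree N)"
    by (rule undirected_tree_structure_tree)
  show "node_part G t \<subseteq> verts G" for t
    by (auto simp: node_part_eq)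
  show "(\<Union>t\<in>nodes N. node_part G t) = verts G"
    using union_node_parts[of "{}"] by simp
next
  fix e assume e: "e \<in> arcs G"
  interpret graph G by (rule graph)
  have "inseparable G N {tail G e, head G e}"
    unfolding inseparable_iff using separationD(4) e wellformed by simp
  then obtain t where "t \<in> side N {}" "{tail G e, head G e} \<subseteq> node_part G t"
    by (rule inseparable_in_part[where R = "{}"]) auto
  then show "\<exists>t\<in>nodes N. tail G e \<in> node_part G t \<and> head G e \<in> node_part G t"
    by blast
qed (use node_part_path in blast)

lemma block_is_part:
  assumes "is_block G N X"
  shows "\<exists>t\<in>nodes N. node_part G t = X"
proof -
  have "inseparable G N X" using assms by (simp add: is_block_def)
  then obtain t where "t \<in> side N {}" "X \<subseteq> node_part G t"
    by (rule inseparable_in_part[where R = "{}"]) auto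
  then show ?thesis
    using assms inseparable_node_part unfolding is_block_def by blast
qed

text \<open>
  The other elements of a node \<open>t\<close> point towards a given \<open>(A, B) \<in> t\<close>, so their left sides contain \<open>B\<close>.
\<close>

lemma separator_subset_part:
  assumes "t \<in> nodes N" "s \<in> t"
  shows "fst s \<inter> snd s \<subseteq> node_part G t"
proof -
  have "s \<in> N" using assms node_subset by blast
  have "fst s \<inter> snd s \<subseteq> fst u" if "u \<in> t" for u
  proof (cases "u = s")
    case False
    then have "opp s \<sqsubseteq> u"
      using node_star[OF assms that] by (simp add: sep_less_imp_le)
    then show ?thesis by (auto simp: sep_le_iff)
  qed simp
  then show ?thesis
    using separationD(1)[OF \<open>s \<in> N\<close>] unfolding node_part_eq by blast
qed

text \<open>
  If the part of \<open>t\<close> is properly contained in an inseparable set \<open>Y\<close>, then \<open>Y\<close> lies on the far side \<open>B\<close>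
  of some \<open>(A, B) \<in> t\<close>, and the part is squeezed into \<open>A \<inter> B\<close>.
\<close>

lemma part_block_or_hub:
  assumes t: "t \<in> nodes N"
  shows "is_block G N (node_part G t) \<or> hub_node G t"
proof (cases "is_block G N (node_part G t)")
  case False
  then obtain Y where Y: "inseparable G N Y" "node_part G t \<subseteq> Y" "Y \<noteq> node_part G t"
    using inseparable_node_part[OF t] unfolding is_block_def by blast
  then obtain s where s: "s \<in> t" "\<not> Y \<subseteq> fst s"
    unfolding inseparable_def node_part_eq by blast
  have "s \<in> N" using t s node_subset by blast
  then have "Y \<subseteq> snd s"
    using Y(1) s(2) unfolding inseparable_iff by blast
  then have "node_part G t \<subseteq> fst s \<inter> snd s"
    using Y(2) s(1) unfolding node_part_eq by blast
  then have "node_part G t = fst s \<inter> snd s"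
    using separator_subset_part[OF t s(1)] by blast
  then have "case s of (A, B) \<Rightarrow> node_part G t = A \<inter> B"
    by (simp add: case_prod_beta)
  then show ?thesis
    unfolding hub_node_def using s(1) by blast
qed simp

lemma induced_separations_structure_tree:
  "induced_separations (structure_tree N) (node_part G) = N"
proof -
  have left: "(\<Union>t\<in>side N {s}. node_part G t) = fst s" if "s \<in> N" for s
  proof -
    have "(\<Union>t\<in>side N {s}. node_part G t) = {x \<in> verts G. \<forall>r\<in>{s}. x \<in> fst r}"
      using not_le_opp[OF that] that by (intro union_node_parts) simp_all
    then show ?thesis using separationD(1)[OF that] by blast
  qed
  have sides: "side N {s} \<noteq> side N {opp s}" if "s \<in> N" for s
  proof
    assume "side N {s} = side N {opp s}"
    then have "fst s = fst (opp s)"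
      using left[OF that] left[OF opp_in[OF that]] by simp
    then show False using separationD(2)[OF that] by simp
  qed
  have pair: "(\<Union>t\<in>side N {s}. node_part G t, \<Union>t\<in>side N {opp s}. node_part G t) = s"
    if "s \<in> N" for s
    using left[OF that] left[OF opp_in[OF that]] by (simp add: prod_eq_iff)
  show ?thesis
  proof (intro equalityI subsetI)
    fix u assume "u \<in> induced_separations (structure_tree N) (node_part G)"
    then obtain s C1 C2 where u: "u = (\<Union>t\<in>C1. node_part G t, \<Union>t\<in>C2. node_part G t)"
      and s: "s \<in> arcs (structure_tree N)" and C: "C1 \<noteq> C2"
        "C1 \<in> pre_digraph.sccs_verts (delete_edge (structure_tree N) s)"
        "C2 \<in> pre_digraph.sccs_verts (delete_edge (structure_tree N) s)"
      unfolding induced_separations_def by blast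
    from s have s: "s \<in> N" by simp
    consider "C1 = side N {s}" "C2 = side N {opp s}" | "C1 = side N {opp s}" "C2 = side N {s}"
      using C unfolding sccs_verts_delete_edge[OF s] by blast
    then have "u = s \<or> u = opp s"
      using pair[OF s] pair[OF opp_in[OF s]] u by cases simp_all
    then show "u \<in> N"
      using s opp_in by blast
  next
    fix s assume s: "s \<in> N"
    show "s \<in> induced_separations (structure_tree N) (node_part G)"
      unfolding induced_separations_def mem_Collect_eq
      using pair[OF s] sides[OF s] sccs_verts_delete_edge[OF s] s
      by (intro exI[of _ s] exI[of _ "side N {s}"] exI[of _ "side N {opp s}"]) simp
  qed
qed

end


section \<open>Subsystems\<close>

text \<open>
  Passing to a subsystem contracts the edges that are given up: the nodes contracted to a node \<open>t'\<close>
  are those that choose every element of \<open>t'\<close>. Since \<open>t'\<close> is a star, they form a nonempty set; since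
  different nodes of the smaller tree differ in their choice on some remaining edge, the sets are
  disjoint; and an edge that is kept joins the sets of its two ends.
\<close>

lemma (in nested_separations) decomposition_le_subsystem:
  assumes "separation_system G N'" "N' \<subseteq> N"
  shows "decomposition_le (structure_tree N') (node_part G) (structure_tree N) (node_part G)"
proof -
  interpret sub: nested_separations G N'
  proof (rule nested_separations.intro)
    have "nested_seps s u" if "s \<in> N'" "u \<in> N'" for s u
      using nested that assms(2) by (meson subsetD)
    then show "nested_separation_system G N'"
      unfolding nested_separation_system_def using assms(1) by (intro conjI ballI)
  qed (rule graph)
  have sub_N: "x \<subseteq> N" if "x \<in> nodes N'" for x
    using sub.node_subset that assms(2) by blast
  have parts: "node_part G x = (\<Union>t\<in>side N x. node_part G t)" if "x \<in> nodes N'" for x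
    using union_node_parts[OF sub_N[OF that] sub.node_not_le_opp[OF that]]
    unfolding node_part_eq by simp
  have nonempty: "side N x \<noteq> {}" if "x \<in> nodes N'" for x
  proof -
    have "inseparable G N {}" by (simp add: inseparable_iff)
    then show ?thesis
      by (rule inseparable_in_part[of "{}" x])
        (use sub_N[OF that] sub.node_not_le_opp[OF that] in blast)+
  qed
  have restrict: "orientation N' x \<subseteq> orientation N t" if "t \<in> side N x" for x t
  proof
    fix s assume "s \<in> orientation N' x"
    then obtain u where "s \<in> N'" "u \<in> x" "u \<sqsubseteq> s"
      unfolding mem_orientation by blast
    then show "s \<in> orientation N t"
      using that assms(2) orientation_upclosed[of u N t s] by blast
  qed
  have disjoint: "x = y" if "x \<in> nodes N'" "y \<in> nodes N'" "t \<in> side N x" "t \<in> side N y" for x y t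
  proof (rule sub.orientation_inject[OF that(1,2)])
    show "orientation N' x \<subseteq> orientation N' y"
    proof
      fix s assume s: "s \<in> orientation N' x"
      then have "s \<in> N'" "s \<in> N" using orientation_subset assms(2) by blast+
      have "s \<in> orientation N t" using s restrict[OF that(3)] by blast
      then have "opp s \<notin> orientation N t"
        using opp_in_orientation_iff \<open>s \<in> N\<close> that(3) by blast
      then have "opp s \<notin> orientation N' y" using restrict[OF that(4)] by blast
      then show "s \<in> orientation N' y"
        using sub.opp_in_orientation_iff[OF that(2) \<open>s \<in> N'\<close>] by blast
    qed
  qed
  have arc: "sep_class N d \<in> side N (sep_class N' d)" if "d \<in> N'" for d
  proof -
    have "d \<in> N" using that assms(2) by blast
    have "r \<in> orientation N (sep_class N d)" if "r \<in> sep_class N' d" for r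
    proof -
      have "r \<in> N" using that assms(2) unfolding mem_sep_class predecessor_def by blast
      moreover have "r = d \<or> opp d \<sqsubset> r"
        using that unfolding mem_sep_class predecessor_def by blast
      ultimately show ?thesis
        unfolding orientation_sep_class[OF \<open>d \<in> N\<close>] by auto
    qed
    then show ?thesis using sep_class_node[OF \<open>d \<in> N\<close>] by blast
  qed
  have "minor_model (structure_tree N') (structure_tree N) (side N)"
    unfolding minor_model_def
  proof (intro conjI ballI impI)
    show "side N x \<subseteq> nodes N" for x by blast
    show "connected (structure_tree N \<restriction> side N x)" if "x \<in> nodes N'" for x
      by (rule connected_side[OF nonempty[OF that]])
    show "side N x \<inter> side N y = {}" if "x \<in> nodes N'" "y \<in> nodes N'" "x \<noteq> y" for x y
      using disjoint[OF that(1,2)] that(3) by blast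
    show "\<exists>e\<in>arcs (structure_tree N). tail (structure_tree N) e \<in> side N (tail (structure_tree N') d) \<and>
        head (structure_tree N) e \<in> side N (head (structure_tree N') d)"
      if "d \<in> arcs (structure_tree N')" for d
    proof (rule bexI[of _ d])
      show "d \<in> arcs (structure_tree N)" using that assms(2) by auto
      have "d \<in> N'" using that by simp
      then show "tail (structure_tree N) d \<in> side N (tail (structure_tree N') d) \<and>
          head (structure_tree N) d \<in> side N (head (structure_tree N') d)"
        unfolding structure_tree_sel using arc[of d] arc[of "opp d"] sub.opp_in by blast
    qed
  qed
  then show ?thesis
    unfolding decomposition_le_def using parts by blast
qed

theorem theorem4p8:
  fixes G :: "('a,'b) pre_digraph" and N :: "'a sep set"
  assumes "graph G" and "nested_separation_system G N"
  shows "tree_decomposition G (structure_tree N) (node_part G) \<and>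
    (\<forall>X. is_block G N X \<longrightarrow> (\<exists>t\<in>verts (structure_tree N). node_part G t = X)) \<and>
    (\<forall>t\<in>verts (structure_tree N). is_block G N (node_part G t) \<or> hub_node G t) \<and>
    induced_separations (structure_tree N) (node_part G) = N \<and>
    (\<forall>N'. separation_system G N' \<and> N' \<subseteq> N \<longrightarrow>
       decomposition_le (structure_tree N') (node_part G) (structure_tree N) (node_part G))"
proof -
  interpret nested_separations G N
    using assms by (rule nested_separations.intro)
  show ?thesis
    using tree_decomposition_structure_tree block_is_part part_block_or_hub
      induced_separations_structure_tree decomposition_le_subsystem by blast
qed

end
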